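(* Let $M,N,m,k$ be non-negative integers, let $\pi_N$ be a monic polynomial of degree $N$, and let $\big((P_n)_{n\ge0},(Q_n)_{n\ge0}\big)$ be a $\pi_N$-coherent pair with index $M$ and order $(m,k)$, with structure coefficients $c_{n,j}$. Let $\mathbf u$ and $\mathbf v$ be the regular functionals with respect to which $(P_n)_{n\ge0}$ and $(Q_n)_{n\ge0}$, respectively, are orthogonal. Assume further that $m<k+N$. Let $\psi(x;n)$ and $\phi(x;n,j)$ be the polynomials defined in the context. For each $j=0,\ldots,k-m+N$ and $n=0,1,\ldots$ set $$\xi(x;n,j):=\binom{k-m+N}{j}\big(\psi(x;n)\big)^{(k-m+N-j)} .$$ Let $\mathcal B(x):=\big[b_{i,j}(x)\big]_{i,j=0}^{k-m+2N}$ be the polynomial matrix of order $k-m+2N+1$ defined by $$b_{i,j}(x):=\begin{cases}\phi(x;i,j)&\text{if }0\le j\le N,\\ -\xi(x;i,j-N)&\text{if }N+1\le j\le k-m+2N.\end{cases}$$ Let $\mathcal B_1(x)$ (resp. $\mathcal B_2(x)$ and $\mathcal B_{N+2}(x)$) be the matrix obtained by replacing the first (resp. the second and the $(N+2)$-th) column of $\mathcal B(x)$ by $\big[\xi(x;0,0),\xi(x;1,0),\ldots,\xi(x;k-m+2N,0)\big]^t$, and set $B(x):=\det\mathcal B(x)$ and $B_j(x):=\det\mathcal B_j(x)$ for $j\in\{1,2,N+2\}$. Assume that the polynomial $B$ does not vanish identically. Then $$B\mathbf v=B_1\mathbf u,\qquad B\,D\mathbf v=B_2\mathbf u,\qquad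 B\,D\mathbf u=B_{N+2}\mathbf u,$$ hence $\mathbf u$ and $\mathbf v$ are semiclassical functionals related by a rational transformation. Moreover, $\mathbf u$ and $\mathbf v$ satisfy $$D(B\mathbf u)=\big(B'+B_{N+2}\big)\mathbf u,\qquad D(BB_1\mathbf v)=\big((BB_1)'+BB_2\big)\mathbf v .$$
   Context: $\mathcal P$ is the vector space of complex polynomials in one variable; functionals are linear maps $\mathbf w:\mathcal P\to\mathbb C$, with action $\langle\mathbf w,p\rangle$. For a polynomial $\Phi$, $\Phi\mathbf w$ is defined by $\langle\Phi\mathbf w,p\rangle:=\langle\mathbf w,\Phi p\rangle$, and $D\mathbf w$ by $\langle D\mathbf w,p\rangle:=-\langle\mathbf w,p'\rangle$. $f^{(r)}$ is the $r$-th derivative in $x$ of the polynomial $f$. A monic orthogonal polynomial sequence (OPS) with respect to $\mathbf w$ is a sequence $(R_n)_{n\ge0}$ of monic polynomials with $\deg R_n=n$ and $\langle\mathbf w,R_jR_n\rangle=k_n\delta_{j,n}$ with all $k_n\ne0$; $\mathbf w$ is regular if such a sequence exists. Pochhammer symbol: $(\alpha)_0:=1$, $(\alpha)_n:=\alpha(\alpha+1)\cdots(\alpha+n-1)$. Normalized derivatives: $P_n^{[m]}(x):=\frac{1}{(n+1)_m}\frac{d^m}{dx^m}P_{n+m}(x)$ and similarly $Q_n^{[k]}$; these are monic of degree $n$. $\pi_N$-coherent pair with index $M$ and order $(m,k)$: $(P_n)_{n\ge0}$ and $(Q_n)_{n\ge0}$ are two monic OPS for which there are complex numbers $c_{n,j}$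 such that $$\pi_N(x)P_n^{[m]}(x)=\sum_{j=n-M}^{n+N}c_{n,j}Q_j^{[k]}(x)\quad(n=0,1,\ldots),$$ with the convention that terms with $j<0$ are zero, and $c_{n,n-M}\ne0$ for all $n\ge M$ (and $c_{n,n+N}=1$ for all $n$, since all polynomials are monic). Polynomials (for $n=0,1,\ldots$ and $j=0,\ldots,N$; in the sum defining $\psi$ terms with negative summation index are taken to be zero): $$\psi(x;n):=\sum_{j=n-N}^{n+M}\frac{(-1)^m(j+1)_m\,c_{j,n}}{\langle\mathbf u,P_{m+j}^2\rangle}P_{m+j}(x),$$ $$\phi(x;n,j):=\frac{(-1)^k(n+1)_k}{\langle\mathbf v,Q_{n+k}^2\rangle}\sum_{\ell=0}^{N-j}\binom{k+N}{\ell}\binom{N-\ell}{N-j-\ell}\pi_N^{(\ell)}(x)\,Q_{n+k}^{(N-j-\ell)}(x).$$ A regular functional $\mathbf w$ is semiclassical if there are nonzero polynomials $\Phi,\Psi$ with $D(\Phi\mathbf w)=\Psi\mathbf w$. Functionals $\mathbf u,\mathbf v$ are related by a rational transformation if there are nonzero polynomials $\Phi,\Psi$ with $\Phi\mathbf u=\Psi\mathbf v$.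
   Formalization: The identities B Dv = B_2 u and D(BB_1 v) = ((BB_1)' + BB_2)v are stated only for N ≥ 1; for N = 0 they are false in general (the second column then belongs to Du), while all other conclusions are kept for every N ≥ 0. *)

theory Defs
  imports
    "HOL-Computational_Algebra.Polynomial"
    "Jordan_Normal_Form.Determinant"
begin

section \<open>Functionals on the space of complex polynomials\<close>

text \<open>A functional is a map \<open>complex poly \<Rightarrow> complex\<close> that is linear in the
  sense of \<open>linear_functional\<close>; the action of \<open>w\<close> on \<open>p\<close> is \<open>w p\<close>.\<close>

type_synonym functional = "complex poly \<Rightarrow> complex"

definition linear_functional :: "functional \<Rightarrow> bool" where
  "linear_functional w \<longleftrightarrow> Vector_Spaces.linear smult (*) w"

definition pmult :: "complex poly \<Rightarrow> functional \<Rightarrow> functional" (infixr "\<odot>" 75) where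
  "\<Phi> \<odot> w = (\<lambda>p. w (\<Phi> * p))"

definition fderiv :: "functional \<Rightarrow> functional" where
  "fderiv w = (\<lambda>p. - w (pderiv p))"

definition monic_OPS :: "functional \<Rightarrow> (nat \<Rightarrow> complex poly) \<Rightarrow> bool" where
  "monic_OPS w R \<longleftrightarrow>
     linear_functional w \<and>
     (\<forall>n. degree (R n) = n \<and> lead_coeff (R n) = 1) \<and>
     (\<exists>\<kappa>. (\<forall>n. \<kappa> n \<noteq> 0) \<and> (\<forall>j n. w (R j * R n) = (if j = n then \<kappa> n else 0)))"

definition regular :: "functional \<Rightarrow> bool" where
  "regular w \<longleftrightarrow> (\<exists>R. monic_OPS w R)"

definition semiclassical :: "functional \<Rightarrow> bool" where
  "semiclassical w \<longleftrightarrow>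
     regular w \<and> (\<exists>\<Phi> \<Psi>. \<Phi> \<noteq> 0 \<and> \<Psi> \<noteq> 0 \<and> fderiv (\<Phi> \<odot> w) = \<Psi> \<odot> w)"

definition rationally_related :: "functional \<Rightarrow> functional \<Rightarrow> bool" where
  "rationally_related u v \<longleftrightarrow> (\<exists>\<Phi> \<Psi>. \<Phi> \<noteq> 0 \<and> \<Psi> \<noteq> 0 \<and> \<Phi> \<odot> u = \<Psi> \<odot> v)"


section \<open>Coherent pairs\<close>

definition normalized_deriv :: "nat \<Rightarrow> (nat \<Rightarrow> complex poly) \<Rightarrow> nat \<Rightarrow> complex poly" where
  "normalized_deriv m R n =
     smult (1 / pochhammer (of_nat (n + 1)) m) ((pderiv ^^ m) (R (n + m)))"

text \<open>\<open>c\<close> are the structure coefficients. Subtraction on \<^typ>\<open>nat\<close> truncates, so the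
  summation range \<open>{n - M..n + N}\<close> implements the convention that the terms with a negative
  index are zero; the same applies to the range \<open>{n - N..n + M}\<close> in \<open>\<psi>\<close>.\<close>

definition coherent_pair ::
  "complex poly \<Rightarrow> nat \<Rightarrow> nat \<Rightarrow> nat \<Rightarrow> nat \<Rightarrow> (nat \<Rightarrow> nat \<Rightarrow> complex) \<Rightarrow>
   (nat \<Rightarrow> complex poly) \<Rightarrow> (nat \<Rightarrow> complex poly) \<Rightarrow> bool" where
  "coherent_pair \<pi> N M m k c P Q \<longleftrightarrow>
     (\<exists>w. monic_OPS w P) \<and> (\<exists>w. monic_OPS w Q) \<and>
     (\<forall>n. \<pi> * normalized_deriv m P n =
          (\<Sum>j\<in>{n - M..n + N}. smult (c n j) (normalized_deriv k Q j))) \<and>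
     (\<forall>n\<ge>M. c n (n - M) \<noteq> 0) \<and>
     (\<forall>n. c n (n + N) = 1)"

definition \<psi> ::
  "nat \<Rightarrow> nat \<Rightarrow> nat \<Rightarrow> (nat \<Rightarrow> nat \<Rightarrow> complex) \<Rightarrow> functional \<Rightarrow>
   (nat \<Rightarrow> complex poly) \<Rightarrow> nat \<Rightarrow> complex poly" where
  "\<psi> N M m c u P n =
     (\<Sum>j\<in>{n - N..n + M}.
        smult ((-1) ^ m * pochhammer (of_nat (j + 1)) m * c j n / u ((P (m + j))\<^sup>2)) (P (m + j)))"

definition \<phi> ::
  "complex poly \<Rightarrow> nat \<Rightarrow> nat \<Rightarrow> functional \<Rightarrow>
   (nat \<Rightarrow> complex poly) \<Rightarrow> nat \<Rightarrow> nat \<Rightarrow> complex poly" where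
  "\<phi> \<pi> N k v Q n j =
     smult ((-1) ^ k * pochhammer (of_nat (n + 1)) k / v ((Q (n + k))\<^sup>2))
       (\<Sum>l=0..N - j.
          smult (of_nat ((k + N) choose l) * of_nat ((N - l) choose (N - j - l)))
            ((pderiv ^^ l) \<pi> * (pderiv ^^ (N - j - l)) (Q (n + k))))"

text \<open>From here on \<open>m < k + N\<close> is intended; the number \<open>k - m + N\<close> is written \<open>k + N - m\<close>
  (and similarly \<open>k + 2 * N - m\<close>) because \<open>k - m\<close> alone may be negative.\<close>

definition \<xi> ::
  "nat \<Rightarrow> nat \<Rightarrow> nat \<Rightarrow> nat \<Rightarrow> (nat \<Rightarrow> nat \<Rightarrow> complex) \<Rightarrow> functional \<Rightarrow>
   (nat \<Rightarrow> complex poly) \<Rightarrow> nat \<Rightarrow> nat \<Rightarrow> complex poly" where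
  "\<xi> N M m k c u P n j =
     smult (of_nat ((k + N - m) choose j)) ((pderiv ^^ (k + N - m - j)) (\<psi> N M m c u P n))"

definition B_mat ::
  "complex poly \<Rightarrow> nat \<Rightarrow> nat \<Rightarrow> nat \<Rightarrow> nat \<Rightarrow> (nat \<Rightarrow> nat \<Rightarrow> complex) \<Rightarrow>
   functional \<Rightarrow> functional \<Rightarrow> (nat \<Rightarrow> complex poly) \<Rightarrow> (nat \<Rightarrow> complex poly) \<Rightarrow>
   complex poly mat" where
  "B_mat \<pi> N M m k c u v P Q =
     mat (k + 2 * N - m + 1) (k + 2 * N - m + 1)
       (\<lambda>(i, j). if j \<le> N then \<phi> \<pi> N k v Q i j else - \<xi> N M m k c u P i (j - N))"

text \<open>\<open>B_mat_repl \<dots> s\<close> replaces the \<open>s\<close>-th column, counted from 1 as in \<open>\<B>\<^sub>1\<close>,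
  \<open>\<B>\<^sub>2\<close>, \<open>\<B>\<^sub>N\<^sub>+\<^sub>2\<close>; the columns of a \<open>mat\<close> are counted from 0. As columns of the linear
  system behind the matrix, the first \<open>N + 1\<close> belong to \<open>v, D v, \<dots>, D\<^sup>N v\<close> and the
  remaining ones to \<open>D u, D\<^sup>2 u, \<dots>\<close>. Hence the second column belongs to \<open>D v\<close> only if
  \<open>N \<ge> 1\<close>; for \<open>N = 0\<close> it is the \<open>(N + 2)\<close>-th column, which belongs to \<open>D u\<close>.\<close>

definition B_mat_repl ::
  "complex poly \<Rightarrow> nat \<Rightarrow> nat \<Rightarrow> nat \<Rightarrow> nat \<Rightarrow> (nat \<Rightarrow> nat \<Rightarrow> complex) \<Rightarrow>
   functional \<Rightarrow> functional \<Rightarrow> (nat \<Rightarrow> complex poly) \<Rightarrow> (nat \<Rightarrow> complex poly) \<Rightarrow>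
   nat \<Rightarrow> complex poly mat" where
  "B_mat_repl \<pi> N M m k c u v P Q s =
     replace_col (B_mat \<pi> N M m k c u v P Q)
       (vec (k + 2 * N - m + 1) (\<lambda>i. \<xi> N M m k c u P i 0)) (s - 1)"

end

theory Submission
  imports Defs
begin

text \<open>Let \<open>q\<^sub>n\<close> be the dual basis of the normalized derivatives of order \<open>k\<close> of \<open>Q\<close>. Since
  \<open>Q\<^sub>n\<^sub>+\<^sub>k\<close> is orthogonal to all polynomials of lower degree, \<open>D\<^sup>k q\<^sub>n\<close> is a multiple of
  \<open>Q\<^sub>n\<^sub>+\<^sub>k v\<close>, and coherence, tested on the basis \<open>P\<close>, says \<open>D\<^sup>m(\<pi> q\<^sub>n) = \<psi>\<^sub>n u\<close>. Computing
  \<open>D\<^sup>k\<^sup>+\<^sup>N(\<pi> q\<^sub>n)\<close> from either identity by the Leibniz rule expresses a combination of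
  \<open>v, D v, \<dots>, D\<^sup>N v\<close> as one of \<open>u, D u, \<dots>\<close>. Finitely many \<open>n\<close> give a square system with
  polynomial coefficients, and Cramer's rule, in the form of the adjugate matrix, solves it up to
  the factor \<open>B\<close>.\<close>

subsection \<open>Linear functionals\<close>

lemma linear_functional_iff:
  "linear_functional w \<longleftrightarrow> (\<forall>p q. w (p + q) = w p + w q) \<and> (\<forall>a p. w (smult a p) = a * w p)"
proof -
  have "Vector_Spaces.linear smult (*) w \<longleftrightarrow>
      (\<forall>p q. w (p + q) = w p + w q) \<and> (\<forall>a p. w (smult a p) = a * w p)"
    unfolding Vector_Spaces.linear_def module_hom_def module_hom_axioms_def vector_space_def Modules.module_def
    by (auto simp: algebra_simps smult_add_right smult_add_left)
  then show ?thesis by (simp add: linear_functional_def)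
qed

context
  fixes w :: functional
  assumes w: "linear_functional w"
begin

lemma functional_add: "w (p + q) = w p + w q"
  and functional_smult: "w (smult a p) = a * w p"
  using w by (auto simp: linear_functional_iff)

lemma functional_zero: "w 0 = 0"
  using functional_smult[of 0 0] by simp

lemma functional_minus: "w (- p) = - w p"
  using functional_smult[of "-1" p] by simp

lemma functional_diff: "w (p - q) = w p - w q"
  using functional_add[of p "- q"] by (simp add: functional_minus)

lemma functional_sum: "w (sum f A) = (\<Sum>a\<in>A. w (f a))"
  by (induction A rule: infinite_finite_induct) (auto simp: functional_add functional_zero)

lemma functional_sum_mult:
  "w (sum f A * p) = (\<Sum>a\<in>A. w (f a * p))"
  by (simp add: sum_distrib_right functional_sum)

lemma linear_pmult: "linear_functional (f \<odot> w)"
  by (auto simp: linear_functional_iff pmult_def algebra_simps functional_add functional_smult)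

lemma linear_fderiv: "linear_functional (fderiv w)"
  by (auto simp: linear_functional_iff fderiv_def pderiv_add pderiv_smult functional_add functional_smult)

lemma fderiv_pmult: "fderiv (f \<odot> w) p = (f \<odot> fderiv w) p + (pderiv f \<odot> w) p"
  by (simp add: fderiv_def pmult_def pderiv_mult functional_add algebra_simps)

end

lemma linear_fderiv_funpow: "linear_functional w \<Longrightarrow> linear_functional ((fderiv ^^ r) w)"
  by (induction r) (auto intro: linear_fderiv)

lemma fderiv_funpow_apply: "(fderiv ^^ r) w p = (-1) ^ r * w ((pderiv ^^ r) p)"
proof (induction r arbitrary: w)
  case (Suc r)
  have "(fderiv ^^ Suc r) w p = (fderiv ^^ r) (fderiv w) p"
    by (simp only: funpow_Suc_right o_apply)
  also have "\<dots> = (-1) ^ Suc r * w ((pderiv ^^ Suc r) p)"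
    by (simp add: Suc.IH fderiv_def)
  finally show ?case .
qed simp

text \<open>Pascal's rule, arranged as the induction step of a Leibniz formula: \<open>a i j\<close>
  stands for a term with \<open>i\<close> derivatives on one factor and \<open>j\<close> on the
  other.\<close>

lemma sum_choose_Suc:
  fixes a :: "nat \<Rightarrow> nat \<Rightarrow> complex"
  shows "(\<Sum>i\<le>Suc r. of_nat (Suc r choose i) * a i (Suc r - i)) =
    (\<Sum>i\<le>r. of_nat (r choose i) * (a (Suc i) (r - i) + a i (Suc (r - i))))"
proof -
  have "(\<Sum>i\<le>Suc r. of_nat (Suc r choose i) * a i (Suc r - i)) =
      a 0 (Suc r) + (\<Sum>i\<le>r. of_nat (r choose i) * a (Suc i) (r - i))
        + (\<Sum>i\<le>r. of_nat (r choose Suc i) * a (Suc i) (r - i))"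
    by (subst sum.atMost_Suc_shift) (simp add: algebra_simps sum.distrib)
  also have "a 0 (Suc r) + (\<Sum>i\<le>r. of_nat (r choose i) * a (Suc i) (r - i))
        + (\<Sum>i\<le>r. of_nat (r choose Suc i) * a (Suc i) (r - i)) =
      (\<Sum>i\<le>r. of_nat (r choose i) * a (Suc i) (r - i))
        + (\<Sum>i\<le>Suc r. of_nat (r choose i) * a i (Suc r - i))"
    by (subst sum.atMost_Suc_shift[of "\<lambda>i. of_nat (r choose i) * a i (Suc r - i)"]) simp
  also have "(\<Sum>i\<le>Suc r. of_nat (r choose i) * a i (Suc r - i)) =
      (\<Sum>i\<le>r. of_nat (r choose i) * a i (Suc (r - i)))"
    by (simp add: Suc_diff_le)
  finally show ?thesis by (simp add: algebra_simps sum.distrib)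
qed

lemma fderiv_funpow_pmult:
  assumes w: "linear_functional w"
  shows "(fderiv ^^ r) (f \<odot> w) p =
    (\<Sum>i\<le>r. of_nat (r choose i) * (fderiv ^^ i) w ((pderiv ^^ (r - i)) f * p))"
proof (induction r arbitrary: p)
  case 0
  show ?case by (simp add: pmult_def)
next
  case (Suc r)
  \<comment> \<open>The product rule for the derivative of \<open>g\<close> times the
    \<open>i\<close>-th derivative of \<open>w\<close>, evaluated at \<open>p\<close>.\<close>
  have *: "(fderiv ^^ Suc i) w (g * p) + (fderiv ^^ i) w (pderiv g * p) = - (fderiv ^^ i) w (g * pderiv p)"
    for i g
    using functional_add[OF linear_fderiv_funpow[OF w, of i], of "g * pderiv p" "pderiv g * p"]
    by (simp add: fderiv_def pderiv_mult add.commute mult.commute)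
  have "(fderiv ^^ Suc r) (f \<odot> w) p =
      (\<Sum>i\<le>r. of_nat (r choose i) * - (fderiv ^^ i) w ((pderiv ^^ (r - i)) f * pderiv p))"
    by (simp add: Suc.IH fderiv_def[of "(fderiv ^^ r) (f \<odot> w)"] sum_negf)
  also have "\<dots> = (\<Sum>i\<le>r. of_nat (r choose i) *
      ((fderiv ^^ Suc i) w ((pderiv ^^ (r - i)) f * p) + (fderiv ^^ i) w ((pderiv ^^ (Suc (r - i))) f * p)))"
    by (intro sum.cong refl) (simp only: *[symmetric] funpow.simps o_apply)
  also have "\<dots> = (\<Sum>i\<le>Suc r. of_nat (Suc r choose i) * (fderiv ^^ i) w ((pderiv ^^ (Suc r - i)) f * p))"
    by (rule sum_choose_Suc[of r "\<lambda>i j. (fderiv ^^ i) w ((pderiv ^^ j) f * p)", symmetric])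
  finally show ?case .
qed

subsection \<open>Orthogonality\<close>

text \<open>Subtracting a multiple of \<open>R n\<close> removes the coefficient of index
  \<open>n\<close>, so a subspace containing the first \<open>n\<close> of the \<open>R i\<close>
  contains every polynomial of degree below \<open>n\<close>. Bounding \<open>p\<close> through its
  coefficients lets \<open>n = 0\<close> mean \<open>p = 0\<close>.\<close>

lemma graded_induct:
  fixes S :: "complex poly \<Rightarrow> bool"
  assumes R: "\<And>n. degree (R n) = n \<and> coeff (R n) n = 1"
    and S0: "S 0" and Sadd: "\<And>p q. S p \<Longrightarrow> S q \<Longrightarrow> S (p + q)"
    and Ssmult: "\<And>a p. S p \<Longrightarrow> S (smult a p)"
    and SR: "\<And>i. i < n \<Longrightarrow> S (R i)"
    and p: "\<And>i. i \<ge> n \<Longrightarrow> coeff p i = 0"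
  shows "S p"
  using SR p
proof (induction n arbitrary: p)
  case 0
  then have "p = 0" by (simp add: poly_eq_iff)
  then show ?case using S0 by simp
next
  case (Suc n)
  let ?q = "p - smult (coeff p n) (R n)"
  have "S ?q"
  proof (rule Suc.IH)
    fix i assume i: "n \<le> i"
    show "coeff ?q i = 0"
    proof (cases "i = n")
      case True
      then show ?thesis using R[of n] by simp
    next
      case False
      then have "coeff (R n) i = 0" using R[of n] i by (intro coeff_eq_0) auto
      then show ?thesis using Suc.prems(2) i False by simp
    qed
  qed (use Suc.prems in auto)
  then have "S (?q + smult (coeff p n) (R n))"
    by (intro Sadd Ssmult Suc.prems(1)) auto
  then show ?case by simp
qed

lemma functional_eqI:
  assumes R: "\<And>n. degree (R n) = n \<and> coeff (R n) n = 1"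
    and "linear_functional w" "linear_functional w'" and "\<And>i. w (R i) = w' (R i)"
  shows "w = w'"
proof
  fix p
  show "w p = w' p"
    by (rule graded_induct[of R "\<lambda>p. w p = w' p" "Suc (degree p)" p])
      (use assms in \<open>auto simp: functional_zero functional_add functional_smult coeff_eq_0\<close>)
qed

context
  fixes w R
  assumes OPS: "monic_OPS w R"
begin

lemma OPS_linear: "linear_functional w"
  and OPS_monic: "degree (R n) = n \<and> coeff (R n) n = 1"
  using OPS unfolding monic_OPS_def by (blast, metis)

lemma OPS_orthogonal: "i \<noteq> j \<Longrightarrow> w (R i * R j) = 0"
  and OPS_norm_nonzero: "w ((R n)\<^sup>2) \<noteq> 0"
  using OPS by (auto simp: monic_OPS_def power2_eq_square)

lemma OPS_regular: "regular w"
  using OPS by (auto simp: regular_def)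

lemma OPS_orthogonal_lower:
  assumes "\<And>i. i \<ge> n \<Longrightarrow> coeff p i = 0"
  shows "w (R n * p) = 0"
  by (rule graded_induct[of R "\<lambda>p. w (R n * p) = 0" n p])
    (use assms in \<open>auto simp: OPS_monic functional_zero[OF OPS_linear] functional_add[OF OPS_linear]
      functional_smult[OF OPS_linear] algebra_simps OPS_orthogonal\<close>)

text \<open>Testing on \<open>R d\<close> with \<open>d = degree f\<close> isolates the leading
  coefficient of \<open>f\<close> times the nonzero norm of \<open>R d\<close>.\<close>

lemma OPS_pmult_eq_zero:
  assumes "\<And>p. (f \<odot> w) p = 0"
  shows "f = 0"
proof (rule ccontr)
  assume f: "f \<noteq> 0"
  define d where "d = degree f"
  define r where "r = f - smult (lead_coeff f) (R d)"
  have "coeff r i = 0" if "i \<ge> d" for i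
    using that OPS_monic[of d]
    by (cases "i = d") (auto simp: r_def d_def coeff_eq_0)
  then have "w (R d * r) = 0" by (rule OPS_orthogonal_lower)
  moreover have "R d * f = smult (lead_coeff f) ((R d)\<^sup>2) + R d * r"
    by (simp add: r_def algebra_simps power2_eq_square)
  moreover have "w (R d * f) = 0"
    using assms[of "R d"] by (simp add: pmult_def mult.commute)
  ultimately have "lead_coeff f * w ((R d)\<^sup>2) = 0"
    by (simp add: functional_add[OF OPS_linear] functional_smult[OF OPS_linear])
  then show False using f OPS_norm_nonzero by simp
qed

end

subsection \<open>The dual basis of the normalized derivatives\<close>

text \<open>The \<open>k\<close>-fold antiderivative without terms of degree below \<open>k\<close>;
  the Pochhammer symbol is the factor that \<open>k\<close> differentiations of a monomial of degree
  \<open>i + k\<close> produce.\<close>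

definition antideriv :: "nat \<Rightarrow> complex poly \<Rightarrow> complex poly" where
  "antideriv k p =
     (\<Sum>i\<le>degree p. monom (coeff p i / pochhammer (of_nat (Suc i)) k) (i + k))"

lemma coeff_antideriv:
  "coeff (antideriv k p) n =
     (if n < k then 0 else coeff p (n - k) / pochhammer (of_nat (Suc (n - k))) k)"
proof (cases "n < k")
  case False
  have "coeff (antideriv k p) n =
      (\<Sum>i\<le>degree p. if i = n - k then coeff p i / pochhammer (of_nat (Suc i)) k else 0)"
    unfolding antideriv_def coeff_sum using False by (intro sum.cong) auto
  also have "\<dots> = coeff p (n - k) / pochhammer (of_nat (Suc (n - k))) k"
    by (auto simp: coeff_eq_0)
  finally show ?thesis using False by simp
qed (auto simp: antideriv_def coeff_sum)

lemma antideriv_add: "antideriv k (p + q) = antideriv k p + antideriv k q"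
  and antideriv_smult: "antideriv k (smult a p) = smult a (antideriv k p)"
  by (auto simp: poly_eq_iff coeff_antideriv add_divide_distrib)

lemma pochhammer_Suc_nonzero: "pochhammer (of_nat (Suc n) :: complex) k \<noteq> 0"
  by (simp add: pochhammer_eq_0_iff) (metis of_nat_Suc of_nat_0_eq_iff of_nat_add add_eq_0_iff nat.distinct(1) add_is_0)

lemma coeff_antideriv_higher_pderiv:
  "n \<ge> k \<Longrightarrow> coeff (antideriv k ((pderiv ^^ k) p)) n = coeff p n"
  using pochhammer_Suc_nonzero[of "n - k" k]
  by (auto simp: coeff_antideriv coeff_higher_pderiv simp del: of_nat_Suc)

text \<open>The coefficient of \<open>Q\<^sub>n\<^sup>[\<^sup>k\<^sup>]\<close> in \<open>p\<close> is read off an arbitrary \<open>k\<close>-fold antiderivative of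
  \<open>p\<close>: two of them differ by a polynomial of degree less than \<open>k\<close>, which is orthogonal to
  \<open>Q\<^sub>n\<^sub>+\<^sub>k\<close>.\<close>

definition dual_deriv :: "nat \<Rightarrow> functional \<Rightarrow> (nat \<Rightarrow> complex poly) \<Rightarrow> nat \<Rightarrow> functional" where
  "dual_deriv k v Q n p =
     pochhammer (of_nat (n + 1)) k / v ((Q (n + k))\<^sup>2) * v (Q (n + k) * antideriv k p)"

context
  fixes v Q
  assumes OPS: "monic_OPS v Q"
begin

lemma linear_dual_deriv: "linear_functional (dual_deriv k v Q n)"
  by (auto simp: linear_functional_iff dual_deriv_def antideriv_add antideriv_smult distrib_left
      functional_add[OF OPS_linear[OF OPS]] functional_smult[OF OPS_linear[OF OPS]])

lemma dual_deriv_higher_pderiv: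
  "dual_deriv k v Q n ((pderiv ^^ k) p) =
     pochhammer (of_nat (n + 1)) k / v ((Q (n + k))\<^sup>2) * v (Q (n + k) * p)"
proof -
  have "v (Q (n + k) * (antideriv k ((pderiv ^^ k) p) - p)) = 0"
    by (rule OPS_orthogonal_lower[OF OPS]) (simp add: coeff_antideriv_higher_pderiv)
  then show ?thesis
    by (simp add: dual_deriv_def right_diff_distrib functional_diff[OF OPS_linear[OF OPS]])
qed

lemma dual_deriv_normalized_deriv:
  "dual_deriv k v Q n (normalized_deriv k Q j) = (if j = n then 1 else 0)"
  using OPS_norm_nonzero[OF OPS, of "n + k"] pochhammer_Suc_nonzero[of n k]
  by (auto simp: normalized_deriv_def functional_smult[OF linear_dual_deriv] dual_deriv_higher_pderiv
      OPS_orthogonal[OF OPS] power2_eq_square simp del: of_nat_Suc)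

lemma fderiv_funpow_dual_deriv:
  "(fderiv ^^ k) (dual_deriv k v Q n) =
     smult ((-1) ^ k * pochhammer (of_nat (n + 1)) k / v ((Q (n + k))\<^sup>2)) (Q (n + k)) \<odot> v"
  by (rule ext) (simp add: fderiv_funpow_apply dual_deriv_higher_pderiv pmult_def
      functional_smult[OF OPS_linear[OF OPS]])

end

subsection \<open>The linear system satisfied by the derivatives\<close>

text \<open>On \<open>P i\<close> with \<open>i < m\<close> both sides vanish. Otherwise coherence
  expands \<pi> times the normalized derivative of index \<open>i - m\<close>, and the dual
  functional selects the coefficient \<open>c (i - m) n\<close>.\<close>

lemma fderiv_funpow_coherent:
  assumes coh: "coherent_pair \<pi> N M m k c P Q"
    and P: "monic_OPS u P" and Q: "monic_OPS v Q"
  shows "(fderiv ^^ m) (\<pi> \<odot> dual_deriv k v Q n) = \<psi> N M m c u P n \<odot> u"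
proof (rule functional_eqI[OF OPS_monic[OF P]])
  let ?q = "dual_deriv k v Q n"
  note q = linear_dual_deriv[OF Q, of k n] and u = OPS_linear[OF P]
  show "linear_functional ((fderiv ^^ m) (\<pi> \<odot> ?q))"
    by (intro linear_fderiv_funpow linear_pmult q)
  show "linear_functional (\<psi> N M m c u P n \<odot> u)"
    by (intro linear_pmult u)
  fix i
  have R: "(\<psi> N M m c u P n \<odot> u) (P i) =
     (\<Sum>j\<in>{n - N..n + M}. if m + j = i then (-1) ^ m * pochhammer (of_nat (j + 1)) m * c j n else 0)"
    unfolding pmult_def \<psi>_def sum_distrib_right functional_sum[OF u]
  proof (intro sum.cong refl)
    fix j
    show "u (smult ((-1) ^ m * pochhammer (of_nat (j + 1)) m * c j n / u ((P (m + j))\<^sup>2)) (P (m + j)) * P i) =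
      (if m + j = i then (-1) ^ m * pochhammer (of_nat (j + 1)) m * c j n else 0)"
      using OPS_norm_nonzero[OF P, of "m + j"]
      by (auto simp: functional_smult[OF u] OPS_orthogonal[OF P] power2_eq_square)
  qed
  show "(fderiv ^^ m) (\<pi> \<odot> ?q) (P i) = (\<psi> N M m c u P n \<odot> u) (P i)"
  proof (cases "i < m")
    case True
    then have "coeff ((pderiv ^^ m) (P i)) l = 0" for l
      using OPS_monic[OF P, of i] by (simp add: coeff_higher_pderiv coeff_eq_0)
    then have "(pderiv ^^ m) (P i) = 0" by (simp add: poly_eq_iff)
    then show ?thesis unfolding R using True
      by (auto simp: fderiv_funpow_apply pmult_def functional_zero[OF q])
  next
    case False
    define i' where "i' = i - m"
    have i: "i = i' + m" using False by (simp add: i'_def)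
    define h where "h = pochhammer (of_nat (i' + 1) :: complex) m"
    have h: "h \<noteq> 0" using pochhammer_Suc_nonzero[of i' m] by (simp add: h_def)
    have "\<pi> * (pderiv ^^ m) (P i) = smult h (\<pi> * normalized_deriv m P i')"
      unfolding normalized_deriv_def h_def[symmetric] i using h by simp
    also have "\<pi> * normalized_deriv m P i' =
        (\<Sum>j\<in>{i' - M..i' + N}. smult (c i' j) (normalized_deriv k Q j))"
      using coh by (auto simp: coherent_pair_def)
    finally have "?q (\<pi> * (pderiv ^^ m) (P i)) = h * (if n \<in> {i' - M..i' + N} then c i' n else 0)"
      by (simp add: functional_smult[OF q] functional_sum[OF q] dual_deriv_normalized_deriv[OF Q]
          if_distrib[of "\<lambda>x. _ * x"] cong: if_cong)
    moreover have "(\<psi> N M m c u P n \<odot> u) (P i) =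
        (if i' \<in> {n - N..n + M} then (-1) ^ m * h * c i' n else 0)"
      unfolding R by (subst sum.delta[symmetric]) (auto simp: i h_def intro!: sum.cong)
    \<comment> \<open>The row range of \<open>c\<close> in the coherence relation and the column
      range in \<open>\<psi>\<close> describe the same band.\<close>
    moreover have "n \<in> {i' - M..i' + N} \<longleftrightarrow> i' \<in> {n - N..n + M}" by auto
    ultimately show ?thesis by (simp add: fderiv_funpow_apply pmult_def)
  qed
qed

text \<open>Leibniz is used twice: first on \<pi> times the dual functional, then, once
  \<open>k\<close> derivatives have turned the latter into \<open>g \<odot> v\<close>, on that
  product. Collecting by the order \<open>j\<close> of the derivative of \<open>v\<close> gives
  \<phi>.\<close>

lemma fderiv_funpow_pmult_dual_deriv:
  assumes deg: "degree \<pi> = N" and Q: "monic_OPS v Q"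
  shows "(fderiv ^^ (k + N)) (\<pi> \<odot> dual_deriv k v Q n) p =
    (\<Sum>j\<le>N. (fderiv ^^ j) v (\<phi> \<pi> N k v Q n j * p))"
proof -
  let ?q = "dual_deriv k v Q n" and ?D = "\<lambda>i. (fderiv ^^ i) v"
  note q = linear_dual_deriv[OF Q, of k n] and v = OPS_linear[OF Q]
  note Dv = linear_fderiv_funpow[OF v]
  define a where "a = (-1) ^ k * pochhammer (of_nat (n + 1)) k / v ((Q (n + k))\<^sup>2)"
  define g where "g = smult a (Q (n + k))"
  let ?t = "\<lambda>l j. of_nat ((k + N) choose l) * (of_nat ((N - l) choose j) *
      ?D j ((pderiv ^^ (N - l - j)) g * ((pderiv ^^ l) \<pi> * p)))"
  \<comment> \<open>At most \<open>N\<close> derivatives can fall on \<pi>, so at least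
    \<open>k\<close> fall on \<open>?q\<close> and \<open>qD\<close> applies.\<close>
  have pi0: "(pderiv ^^ l) \<pi> = 0" if "l > N" for l
    using that deg by (simp add: poly_eq_iff coeff_higher_pderiv coeff_eq_0)
  have qD: "(fderiv ^^ (N - l + k)) ?q r =
      (\<Sum>j\<le>N - l. of_nat ((N - l) choose j) * ?D j ((pderiv ^^ (N - l - j)) g * r))" for l r
    by (simp add: funpow_add fderiv_funpow_dual_deriv[OF Q] fderiv_funpow_pmult[OF v] g_def a_def)
  have "(fderiv ^^ (k + N)) (\<pi> \<odot> ?q) p =
      (\<Sum>i\<le>k + N. of_nat ((k + N) choose i) * (fderiv ^^ i) ?q ((pderiv ^^ (k + N - i)) \<pi> * p))"
    by (rule fderiv_funpow_pmult[OF q])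
  also have "\<dots> = (\<Sum>l\<le>k + N. of_nat ((k + N) choose l) *
      (fderiv ^^ (k + N - l)) ?q ((pderiv ^^ l) \<pi> * p))"
    by (rule sum.reindex_bij_witness[of _ "\<lambda>l. k + N - l" "\<lambda>l. k + N - l"])
      (auto simp: binomial_symmetric[symmetric])
  also have "\<dots> = (\<Sum>l\<le>N. of_nat ((k + N) choose l) *
      (fderiv ^^ (k + N - l)) ?q ((pderiv ^^ l) \<pi> * p))"
    by (rule sum.mono_neutral_right) (auto simp: pi0 functional_zero[OF linear_fderiv_funpow[OF q]])
  also have "\<dots> = (\<Sum>l\<in>{..N}. \<Sum>j\<in>{j \<in> {..N}. l + j \<le> N}. ?t l j)"
  proof (rule sum.cong[OF refl])
    fix l assume "l \<in> {..N}"
    then have e: "k + N - l = N - l + k" and s: "{..N - l} = {j \<in> {..N}. l + j \<le> N}" by auto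
    show "of_nat ((k + N) choose l) * (fderiv ^^ (k + N - l)) ?q ((pderiv ^^ l) \<pi> * p) =
        (\<Sum>j\<in>{j \<in> {..N}. l + j \<le> N}. ?t l j)"
      unfolding e qD sum_distrib_left s ..
  qed
  also have "\<dots> = (\<Sum>j\<in>{..N}. \<Sum>l\<in>{l \<in> {..N}. l + j \<le> N}. ?t l j)"
    by (rule sum.swap_restrict) auto
  also have "\<dots> = (\<Sum>j\<le>N. ?D j (\<phi> \<pi> N k v Q n j * p))"
  proof (rule sum.cong[OF refl])
    fix j assume j: "j \<in> {..N}"
    then have s: "{l \<in> {..N}. l + j \<le> N} = {0..N - j}" by auto
    show "(\<Sum>l\<in>{l \<in> {..N}. l + j \<le> N}. ?t l j) = ?D j (\<phi> \<pi> N k v Q n j * p)"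
      unfolding \<phi>_def a_def[symmetric] s mult_smult_left
        functional_smult[OF Dv] functional_sum_mult[OF Dv] sum_distrib_left
    proof (rule sum.cong[OF refl])
      fix l assume "l \<in> {0..N - j}"
      with j have l: "l + j \<le> N" by auto
      then have "(N - l) choose j = (N - l) choose (N - j - l)" "N - l - j = N - j - l"
        using binomial_symmetric[of j "N - l"] by (auto simp: add.commute)
      then show "?t l j = a * (of_nat ((k + N) choose l) * of_nat ((N - l) choose (N - j - l)) *
          ?D j ((pderiv ^^ l) \<pi> * (pderiv ^^ (N - j - l)) (Q (n + k)) * p))"
        by (simp add: g_def higher_pderiv_smult functional_smult[OF Dv] mult_ac)
    qed
  qed
  finally show ?thesis .
qed

text \<open>Both sides are the derivative of order \<open>k + N\<close> of \<pi> times the dual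
  functional; on the right, \<open>m\<close> of these derivatives produce \<open>\<psi>\<close>
  times \<open>u\<close>, and Leibniz for the remaining ones has the coefficients \<xi>.\<close>

lemma derivative_relation:
  assumes deg: "degree \<pi> = N" and coh: "coherent_pair \<pi> N M m k c P Q"
    and P: "monic_OPS u P" and Q: "monic_OPS v Q" and m: "m \<le> k + N"
  shows "(\<Sum>j\<le>N. (fderiv ^^ j) v (\<phi> \<pi> N k v Q n j * p)) =
    (\<Sum>j\<le>k + N - m. (fderiv ^^ j) u (\<xi> N M m k c u P n j * p))"
proof -
  note u = OPS_linear[OF P]
  have "(fderiv ^^ (k + N)) (\<pi> \<odot> dual_deriv k v Q n) =
      (fderiv ^^ (k + N - m)) ((fderiv ^^ m) (\<pi> \<odot> dual_deriv k v Q n))"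
    using m by (metis funpow_add o_apply le_add_diff_inverse2)
  then show ?thesis
    unfolding fderiv_funpow_pmult_dual_deriv[OF deg Q, symmetric] fderiv_funpow_coherent[OF coh P Q]
    by (simp add: fderiv_funpow_pmult[OF u] \<xi>_def functional_smult[OF linear_fderiv_funpow[OF u]])
qed

text \<open>Functionals form a module over the polynomials, where the matrix cannot be inverted;
  multiplying the system by row \<open>s\<close> of the adjugate isolates the unknown
  \<open>x s\<close>.\<close>

lemma cramer_functional:
  fixes A :: "complex poly mat" and x :: "nat \<Rightarrow> functional"
  assumes A: "A \<in> carrier_mat d d" and b: "b \<in> carrier_vec d" and s: "s < d"
    and x: "\<And>j. j < d \<Longrightarrow> linear_functional (x j)" and u: "linear_functional u"
    and sys: "\<And>i p. i < d \<Longrightarrow> (\<Sum>j<d. x j (A $$ (i, j) * p)) = u (b $ i * p)"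
  shows "det A \<odot> x s = det (replace_col A b s) \<odot> u"
proof
  fix p
  have adj: "(\<Sum>i<d. cofactor A i s * A $$ (i, j)) = (if j = s then det A else 0)" if j: "j < d" for j
  proof -
    have "(\<Sum>i<d. cofactor A i s * A $$ (i, j)) = (adj_mat A * A) $$ (s, j)"
      using A s j by (auto simp: adj_mat_def times_mat_def scalar_prod_def lessThan_atLeast0 intro!: sum.cong)
    then show ?thesis using s j by (simp add: adj_mat(3)[OF A])
  qed
  \<comment> \<open>Expansion along the replaced column, whose cofactors do not see that
    column.\<close>
  have rep: "det (replace_col A b s) = (\<Sum>i<d. b $ i * cofactor A i s)"
  proof -
    have C: "replace_col A b s \<in> carrier_mat d d" using A by (auto simp: replace_col_def)
    have "cofactor (replace_col A b s) i s = cofactor A i s" for i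
      using A by (auto simp: cofactor_def replace_col_def mat_delete_def intro!: arg_cong[of _ _ det] eq_matI)
    then show ?thesis using A s
      by (subst laplace_expansion_column[OF C s]) (auto simp: replace_col_def intro!: sum.cong)
  qed
  have "(det (replace_col A b s) \<odot> u) p = (\<Sum>i<d. u (b $ i * (cofactor A i s * p)))"
    by (simp add: pmult_def rep sum_distrib_right functional_sum[OF u] mult.assoc)
  also have "\<dots> = (\<Sum>i<d. \<Sum>j<d. x j (A $$ (i, j) * (cofactor A i s * p)))"
    by (simp add: sys)
  also have "\<dots> = (\<Sum>j<d. \<Sum>i<d. x j (A $$ (i, j) * (cofactor A i s * p)))"
    by (rule sum.swap)
  also have "\<dots> = (\<Sum>j<d. x j ((\<Sum>i<d. cofactor A i s * A $$ (i, j)) * p))"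
    by (intro sum.cong refl) (simp add: functional_sum[OF x] sum_distrib_right mult.assoc mult.left_commute)
  also have "\<dots> = (\<Sum>j<d. if j = s then x s (det A * p) else 0)"
    by (intro sum.cong refl) (auto simp: adj functional_zero[OF x])
  also have "\<dots> = x s (det A * p)" using s by simp
  finally show "(det A \<odot> x s) p = (det (replace_col A b s) \<odot> u) p" by (simp add: pmult_def)
qed

text \<open>The unknowns of the system. \<open>u\<close> itself is not among them, as it forms the
  right-hand side: index \<open>N + 1\<close> is already the first derivative of
  \<open>u\<close>.\<close>

definition derivs :: "nat \<Rightarrow> functional \<Rightarrow> functional \<Rightarrow> nat \<Rightarrow> functional" where
  "derivs N u v j = (if j \<le> N then (fderiv ^^ j) v else (fderiv ^^ (j - N)) u)"

text \<open>In \<open>derivative_relation\<close> the term in \<open>u\<close> stays on the right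
  and the other terms in derivatives of \<open>u\<close> move left, whence the minus signs in the
  matrix.\<close>

lemma B_mat_cramer:
  assumes deg: "degree \<pi> = N" and coh: "coherent_pair \<pi> N M m k c P Q"
    and P: "monic_OPS u P" and Q: "monic_OPS v Q" and m: "m \<le> k + N"
    and s: "1 \<le> s" "s \<le> k + 2 * N - m + 1"
  shows "det (B_mat \<pi> N M m k c u v P Q) \<odot> derivs N u v (s - 1) =
    det (B_mat_repl \<pi> N M m k c u v P Q s) \<odot> u"
  unfolding B_mat_repl_def
proof (rule cramer_functional)
  let ?d = "k + 2 * N - m + 1" and ?L = "k + N - m"
  note u = OPS_linear[OF P] and v = OPS_linear[OF Q]
  show "B_mat \<pi> N M m k c u v P Q \<in> carrier_mat ?d ?d" by (simp add: B_mat_def)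
  show "linear_functional (derivs N u v j)" for j
    by (simp add: derivs_def linear_fderiv_funpow u v)
  show "linear_functional u" by (rule u)
  fix i p assume i: "i < ?d"
  let ?f = "\<lambda>j. derivs N u v j (B_mat \<pi> N M m k c u v P Q $$ (i, j) * p)"
  have d: "?d = Suc N + ?L" using m by simp
  have split: "(\<Sum>j<a + b. f j) = (\<Sum>j<a. f j) + (\<Sum>j<b. f (a + j))"
    for a b and f :: "nat \<Rightarrow> complex"
    by (induction b) (simp_all add: add.assoc)
  have "(\<Sum>j<Suc N. ?f j) = (\<Sum>j\<le>N. (fderiv ^^ j) v (\<phi> \<pi> N k v Q i j * p))"
    using i m by (intro sum.cong) (auto simp: derivs_def B_mat_def)
  also have "\<dots> = u (\<xi> N M m k c u P i 0 * p)
      + (\<Sum>j<?L. (fderiv ^^ Suc j) u (\<xi> N M m k c u P i (Suc j) * p))"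
    unfolding derivative_relation[OF deg coh P Q m] by (simp only: sum.atMost_shift funpow_0)
  also have "(\<Sum>j<?L. (fderiv ^^ Suc j) u (\<xi> N M m k c u P i (Suc j) * p)) =
      - (\<Sum>j<?L. ?f (Suc N + j))"
    unfolding sum_negf[symmetric]
  proof (rule sum.cong[OF refl])
    fix j assume "j \<in> {..<?L}"
    then have "B_mat \<pi> N M m k c u v P Q $$ (i, Suc N + j) = - \<xi> N M m k c u P i (Suc j)"
      "derivs N u v (Suc N + j) = (fderiv ^^ Suc j) u"
      using i m by (simp_all add: B_mat_def derivs_def)
    then show "(fderiv ^^ Suc j) u (\<xi> N M m k c u P i (Suc j) * p) = - ?f (Suc N + j)"
      by (simp only: mult_minus_left functional_minus[OF linear_fderiv_funpow[OF u]] minus_minus)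
  qed
  finally show "(\<Sum>j<?d. ?f j) = u (vec ?d (\<lambda>i. \<xi> N M m k c u P i 0) $ i * p)"
    using i unfolding d split by simp
qed (use s in auto)

subsection \<open>Semiclassical functionals\<close>

text \<open>Every polynomial is a derivative, so \<open>g = 0\<close> would make
  \<open>f \<odot> w\<close> vanish, against regularity.\<close>

lemma fderiv_pmult_nonzero:
  assumes w: "monic_OPS w R" and f: "f \<noteq> 0" and eq: "fderiv (f \<odot> w) = g \<odot> w"
  shows "g \<noteq> 0"
proof
  assume "g = 0"
  then have *: "w (f * pderiv p) = 0" for p
    using fun_cong[OF eq, of p] functional_zero[OF OPS_linear[OF w]] by (simp add: fderiv_def pmult_def)
  have "(f \<odot> w) p = 0" for p
  proof -
    have "pderiv (antideriv 1 p) = p"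
      by (simp add: poly_eq_iff coeff_pderiv coeff_antideriv field_simps del: of_nat_Suc)
    then show ?thesis using *[of "antideriv 1 p"] by (simp add: pmult_def)
  qed
  then show False using OPS_pmult_eq_zero[OF w] f by blast
qed

lemma semiclassicalI:
  assumes "monic_OPS w R" "f \<noteq> 0" "fderiv (f \<odot> w) = g \<odot> w"
  shows "semiclassical w"
  using assms fderiv_pmult_nonzero[OF assms] OPS_regular[OF assms(1)] by (auto simp: semiclassical_def)

theorem theorem2p2:
  fixes M N m k :: nat
    and \<pi> :: "complex poly"
    and P Q :: "nat \<Rightarrow> complex poly"
    and c :: "nat \<Rightarrow> nat \<Rightarrow> complex"
    and u v :: functional
    and B B1 B2 BN2 :: "complex poly"
  assumes "degree \<pi> = N" and "lead_coeff \<pi> = 1"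
    and "coherent_pair \<pi> N M m k c P Q"
    and "monic_OPS u P" and "monic_OPS v Q"
    and "m < k + N"
    and "B = det (B_mat \<pi> N M m k c u v P Q)"
    and "B1 = det (B_mat_repl \<pi> N M m k c u v P Q 1)"
    and "B2 = det (B_mat_repl \<pi> N M m k c u v P Q 2)"
    and "BN2 = det (B_mat_repl \<pi> N M m k c u v P Q (N + 2))"
    and "B \<noteq> 0"
  shows "B \<odot> v = B1 \<odot> u
    \<and> (N \<ge> 1 \<longrightarrow> B \<odot> fderiv v = B2 \<odot> u)
    \<and> B \<odot> fderiv u = BN2 \<odot> u
    \<and> semiclassical u \<and> semiclassical v \<and> rationally_related u v
    \<and> fderiv (B \<odot> u) = (pderiv B + BN2) \<odot> u
    \<and> (N \<ge> 1 \<longrightarrow> fderiv ((B * B1) \<odot> v) = (pderiv (B * B1) + B * B2) \<odot> v)"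
proof -
  note deg = assms(1) and coh = assms(3) and P = assms(4) and Q = assms(5) and m = assms(6)
  note B = assms(7-10) and B0 = assms(11)
  note u = OPS_linear[OF P] and v = OPS_linear[OF Q]
  note cramer = B_mat_cramer[OF deg coh P Q less_imp_le[OF m], folded B(1)]
  have B1: "B \<odot> v = B1 \<odot> u"
    using cramer[of 1] m by (simp add: derivs_def B)
  have B2: "B \<odot> fderiv v = B2 \<odot> u" if "N \<ge> 1"
    using cramer[of 2] m that by (simp add: derivs_def B)
  \<comment> \<open>Column \<open>N + 2\<close> exists because \<open>m < k + N\<close>.\<close>
  have BN2: "B \<odot> fderiv u = BN2 \<odot> u"
    using cramer[of "N + 2"] m by (simp add: derivs_def B)
  have B1': "v (B * q) = u (B1 * q)" and B2': "N \<ge> 1 \<Longrightarrow> fderiv v (B * q) = u (B2 * q)"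
    and BN2': "fderiv u (B * q) = u (BN2 * q)" for q
    using fun_cong[OF B1, of q] fun_cong[OF B2, of q] fun_cong[OF BN2, of q] by (simp_all add: pmult_def)
  have B1_0: "B1 \<noteq> 0"
  proof
    assume "B1 = 0"
    then have "(B \<odot> v) p = 0" for p
      using B1'[of p] functional_zero[OF u] by (simp add: pmult_def)
    then show False using OPS_pmult_eq_zero[OF Q] B0 by blast
  qed
  have Du: "fderiv (B \<odot> u) = (pderiv B + BN2) \<odot> u"
    by (rule ext, simp add: fderiv_pmult[OF u] BN2)
      (simp add: pmult_def distrib_right functional_add[OF u])
  have Dv: "fderiv ((B * B1) \<odot> v) = (pderiv (B * B1) + B * B2) \<odot> v" if "N \<ge> 1"
  proof
    fix p
    \<comment> \<open>Both sides equal \<open>u (B1 * B2 * p)\<close>: the relations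
      \<open>B2\<close> and \<open>B1\<close> pass from \<open>v\<close> to
      \<open>u\<close>.\<close>
    have "fderiv v (B * (B1 * p)) = v (B * (B2 * p))"
      using B2'[OF that, of "B1 * p"] B1'[of "B2 * p"] by (simp add: mult.left_commute)
    then show "fderiv ((B * B1) \<odot> v) p = ((pderiv (B * B1) + B * B2) \<odot> v) p"
      by (simp add: fderiv_pmult[OF v]) (simp add: pmult_def distrib_right functional_add[OF v] mult.assoc)
  qed
  \<comment> \<open>Unlike \<open>Dv\<close>, this relation does not involve \<open>D v\<close> as an unknown of the linear
    system, so it also covers \<open>N = 0\<close>.\<close>
  have "fderiv ((B * B1 * B) \<odot> v) = (B * (B1 * (pderiv B + BN2) + 2 * B * pderiv B1)) \<odot> v"
  proof
    fix p
    let ?g = "B1 * (pderiv B + BN2) + 2 * B * pderiv B1"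
    have "fderiv ((B * B1 * B) \<odot> v) p = - v (B * (B * B1 * pderiv p))"
      by (simp add: fderiv_def pmult_def mult_ac)
    also have "\<dots> = - u (B1 * (B * B1 * pderiv p))" by (simp add: B1')
    \<comment> \<open>Completing to the derivative of \<open>B1 * B1 * p\<close> brings in
      \<open>fderiv (B \<odot> u)\<close>, which \<open>Du\<close> evaluates.\<close>
    also have "B1 * (B * B1 * pderiv p) = B * pderiv (B1 * B1 * p) - B * pderiv (B1 * B1) * p"
      by (simp add: pderiv_mult algebra_simps)
    also have "- u \<dots> = fderiv (B \<odot> u) (B1 * B1 * p) + u (B * pderiv (B1 * B1) * p)"
      by (simp add: functional_diff[OF u] fderiv_def pmult_def)
    also have "\<dots> = u (B1 * (?g * p))"
      unfolding fun_cong[OF Du, of "B1 * B1 * p", unfolded pmult_def[of "pderiv B + BN2"]]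
        functional_add[OF u, symmetric]
      by (rule arg_cong[of _ _ u]) (simp add: pderiv_mult algebra_simps)
    \<comment> \<open>The remaining factor \<open>B1\<close> allows the return from \<open>u\<close>
      to \<open>v\<close>.\<close>
    also have "\<dots> = ((B * ?g) \<odot> v) p" by (simp add: pmult_def B1'[symmetric] mult.assoc)
    finally show "fderiv ((B * B1 * B) \<odot> v) p = ((B * ?g) \<odot> v) p" .
  qed
  then have "semiclassical v" using B0 B1_0 by (intro semiclassicalI[OF Q]) auto
  moreover have "semiclassical u" using semiclassicalI[OF P B0 Du] .
  moreover have "rationally_related u v"
    unfolding rationally_related_def using B0 B1_0 B1 by metis
  ultimately show ?thesis using B1 B2 BN2 Du Dv by blast
qed

end
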